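(* Let $r\ge 0$ be an integer and let $c_0,\dots,c_r$ and $x_0,\dots,x_r$ be real numbers. Then $$\det\left( (c_jx_i+1)^r\right)_{0 \leq i,j \leq r} = \prod_{0 \leq i < j \leq r}(x_i-x_j)\prod_{0 \leq i < j \leq r}(c_i-c_j) \prod_{i=0}^r \binom{r}{i}.$$
   Context: The matrix is $(r+1)\times(r+1)$ with rows indexed by $i$ and columns by $j$. Any quantity raised to the power $0$ equals $1$. *)

theory Defs
  imports Complex_Main "Jordan_Normal_Form.Determinant"
begin

end

theory Submission
  imports Defs
begin

text \<open>
  By the binomial theorem the matrix is the product of V(x), D and the transpose of V(c), with
  Vandermonde matrices V and the diagonal matrix D of binomial coefficients. Multiplying a Vandermonde matrix by the
  unitriangular matrix of coefficients of the Newton basis makes it lower triangular, which gives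
  its determinant as a product of differences x j - x i with i < j. Passing to x i - x j changes
  the sign of both Vandermonde products by the same factor, so the signs cancel.
\<close>

definition vandermonde_mat :: "nat \<Rightarrow> (nat \<Rightarrow> 'a :: comm_ring_1) \<Rightarrow> 'a mat" where
  "vandermonde_mat n x = mat n n (\<lambda>(i, k). x i ^ k)"

lemma vandermonde_mat_carrier [simp]: "vandermonde_mat n x \<in> carrier_mat n n"
  by (simp add: vandermonde_mat_def)

text \<open>Monic of degree \<open>j\<close> with roots \<open>x 0\<close>, ...,
  \<open>x (j - 1)\<close>: the degree makes the matrix of coefficients triangular, the roots make
  the matrix of values at the nodes triangular.\<close>

definition newton_poly :: "(nat \<Rightarrow> 'a :: idom) \<Rightarrow> nat \<Rightarrow> 'a poly" where
  "newton_poly x j = (\<Prod>k<j. [:- x k, 1:])"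

lemma poly_newton_poly: "poly (newton_poly x j) a = (\<Prod>k<j. a - x k)"
  by (simp add: newton_poly_def poly_prod)

lemma degree_newton_poly [simp]: "degree (newton_poly x j) = j"
  by (simp add: newton_poly_def degree_prod_eq_sum_degree)

lemma coeff_newton_poly_self [simp]: "coeff (newton_poly x j) j = 1"
proof -
  have "lead_coeff (newton_poly x j) = 1"
    by (simp add: newton_poly_def lead_coeff_prod)
  then show ?thesis by simp
qed

lemma det_vandermonde_mat:
  fixes x :: "nat \<Rightarrow> 'a :: idom"
  shows "det (vandermonde_mat n x) = (\<Prod>j<n. \<Prod>i<j. x j - x i)"
proof -
  define U where "U = mat n n (\<lambda>(k, j). coeff (newton_poly x j) k)"
  define L where "L = mat n n (\<lambda>(i, j). poly (newton_poly x j) (x i))"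
  have U: "U \<in> carrier_mat n n" and L: "L \<in> carrier_mat n n"
    by (simp_all add: U_def L_def)
  \<comment> \<open>Pairing the powers of \<open>x i\<close> with the coefficients of a polynomial
    of degree below \<open>n\<close> evaluates it at \<open>x i\<close>.\<close>
  have "vandermonde_mat n x * U = L"
  proof (rule eq_matI)
    fix i j assume "i < dim_row L" "j < dim_col L"
    then have ij: "i < n" "j < n" by (auto simp: L_def)
    have "(vandermonde_mat n x * U) $$ (i, j) =
        (\<Sum>k<n. x i ^ k * coeff (newton_poly x j) k)"
      using ij by (simp add: vandermonde_mat_def U_def scalar_prod_def atLeast0LessThan)
    also have "\<dots> = (\<Sum>k\<le>j. coeff (newton_poly x j) k * x i ^ k)"
      using ij by (intro sum.mono_neutral_cong_right) (auto simp: coeff_eq_0 mult.commute)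
    also have "\<dots> = L $$ (i, j)"
      using ij by (simp add: L_def poly_altdef)
    finally show "(vandermonde_mat n x * U) $$ (i, j) = L $$ (i, j)" .
  qed (simp_all add: vandermonde_mat_def U_def L_def)
  then have "det (vandermonde_mat n x) * det U = det L"
    by (metis det_mult vandermonde_mat_carrier U)
  moreover have "det U = 1"
  proof -
    have "upper_triangular U"
      by (auto simp: U_def coeff_eq_0)
    then have "det U = prod_list (diag_mat U)"
      using U by (rule det_upper_triangular)
    then show ?thesis
      by (simp add: prod_list_diag_prod U_def)
  qed
  moreover have "det L = (\<Prod>j<n. \<Prod>i<j. x j - x i)"
  proof -
    \<comment> \<open>For \<open>i < j\<close> the node \<open>x i\<close> is a root of
      \<open>newton_poly x j\<close>.\<close>
    have "L $$ (i, j) = 0" if "i < j" "j < n" for i j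
      using that by (auto simp: L_def poly_newton_poly)
    then have "det L = prod_list (diag_mat L)"
      using L by (rule det_lower_triangular)
    then show ?thesis
      by (simp add: prod_list_diag_prod L_def poly_newton_poly atLeast0LessThan)
  qed
  ultimately show ?thesis by simp
qed

text \<open>Each entry expands to the sum over \<open>k \<le> r\<close> of
  \<open>x i ^ k * ((r choose k) * c j ^ k)\<close>, which separates \<open>i\<close> from
  \<open>j\<close>. There are \<open>r + 1\<close> terms, exactly the size of the matrix, so all
  factors are square and the determinant is multiplicative.\<close>

lemma det_powers_bilinear:
  fixes x c :: "nat \<Rightarrow> 'a :: idom"
  shows "det (mat (r + 1) (r + 1) (\<lambda>(i, j). (c j * x i + 1) ^ r)) =
    det (vandermonde_mat (r + 1) x) * det (vandermonde_mat (r + 1) c) *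
    (\<Prod>i\<le>r. of_nat (r choose i))"
proof -
  let ?n = "r + 1"
  define D where "D = mat ?n ?n (\<lambda>(k, l). if k = l then of_nat (r choose k) else (0 :: 'a))"
  define B where "B = mat ?n ?n (\<lambda>(k, j). of_nat (r choose k) * c j ^ k)"
  have D: "D \<in> carrier_mat ?n ?n" and B: "B \<in> carrier_mat ?n ?n"
    by (simp_all add: D_def B_def)
  have "D * transpose_mat (vandermonde_mat ?n c) = B"
    by (rule eq_matI)
      (auto simp: D_def B_def vandermonde_mat_def scalar_prod_def if_distrib[of "\<lambda>a. a * _"]
        cong: if_cong)
  then have "det B = det D * det (vandermonde_mat ?n c)"
    by (metis det_mult det_transpose transpose_carrier_mat vandermonde_mat_carrier D)
  moreover have "det D = (\<Prod>i\<le>r. of_nat (r choose i))"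
  proof -
    have "upper_triangular D"
      by (auto simp: D_def)
    then have "det D = prod_list (diag_mat D)"
      using D by (rule det_upper_triangular)
    then show ?thesis
      by (simp add: prod_list_diag_prod D_def atLeast0LessThan lessThan_Suc_atMost)
  qed
  moreover have "mat ?n ?n (\<lambda>(i, j). (c j * x i + 1) ^ r) = vandermonde_mat ?n x * B"
    by (rule eq_matI)
      (auto simp: vandermonde_mat_def B_def scalar_prod_def binomial_ring power_mult_distrib
        atLeast0LessThan lessThan_Suc_atMost mult_ac intro!: sum.cong)
  ultimately show ?thesis
    using B by (simp add: det_mult[of _ "Suc r"] mult_ac)
qed

text \<open>Links the product over pairs in the theorem with the nested form, larger index outside,
  that the Vandermonde determinant produces.\<close>

lemma prod_pairs_less:
  "(\<Prod>(i, j) \<in> {(i, j). 0 \<le> i \<and> i < j \<and> j \<le> r}. f i j) =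
    (\<Prod>j<r + 1. \<Prod>i<j. f i j :: 'a :: comm_monoid_mult)" for r :: nat
proof -
  have "(\<Prod>j<r + 1. \<Prod>i<j. f i j) = (\<Prod>(j, i) \<in> Sigma {..<r + 1} lessThan. f i j)"
    by (rule prod.Sigma) auto
  also have "\<dots> = (\<Prod>(i, j) \<in> {(i, j). 0 \<le> i \<and> i < j \<and> j \<le> r}. f i j)"
    by (rule prod.reindex_bij_witness[of _ prod.swap prod.swap]) auto
  finally show ?thesis by simp
qed

theorem lemma3:
  fixes r :: nat and c x :: "nat \<Rightarrow> real"
  shows "det (mat (r + 1) (r + 1) (\<lambda>(i, j). (c j * x i + 1) ^ r)) =
    (\<Prod>(i, j) \<in> {(i, j). 0 \<le> i \<and> i < j \<and> j \<le> r}. x i - x j) *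
    (\<Prod>(i, j) \<in> {(i, j). 0 \<le> i \<and> i < j \<and> j \<le> r}. c i - c j) *
    (\<Prod>i = 0..r. real (r choose i))"
proof -
  \<comment> \<open>The signs cancel pair by pair, so merging the two products into one over the
    same pairs avoids counting them.\<close>
  have "(x i - x j) * (c i - c j) = (x j - x i) * (c j - c i)" for i j
    by (simp add: algebra_simps)
  then show ?thesis
    unfolding det_powers_bilinear det_vandermonde_mat prod_pairs_less atLeast0AtMost
      prod.distrib[symmetric] by simp
qed

end
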